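(* (i) Let $\alpha,\beta>-1$. For every integer $n\ge1$ and every $x\in[-1,1]$, $$\frac{[P_n^{(\alpha,\beta)}(x)]^2}{P_n^{(\alpha,\beta)}(1)}+\frac{n+\beta}{2n+\alpha+\beta+1}\,\frac{[P_{n-1}^{(\alpha+1,\beta)}(x)]^2}{P_{n-1}^{(\alpha+1,\beta)}(1)}\ \ge\ \frac{n+\alpha+\beta+1}{2n+\alpha+\beta+1}\,\frac{[P_n^{(\alpha+1,\beta)}(x)]^2}{P_n^{(\alpha+1,\beta)}(1)} .$$ (ii) Let $\alpha>-1$. For every integer $n\ge1$ and every $x\in[0,\infty)$, $$\frac{[L_n^{(\alpha)}(x)]^2}{L_n^{(\alpha)}(0)}+\frac{[L_{n-1}^{(\alpha+1)}(x)]^2}{L_{n-1}^{(\alpha+1)}(0)}\ \ge\ \frac{[L_n^{(\alpha+1)}(x)]^2}{L_n^{(\alpha+1)}(0)} .$$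
   Context: $P_n^{(\alpha,\beta)}$ denotes the Jacobi polynomial of degree $n$ in the standard (Szegő) normalization: it is orthogonal with respect to $(1-x)^\alpha(1+x)^\beta$ on $[-1,1]$ and $P_n^{(\alpha,\beta)}(1)=\binom{n+\alpha}{n}$. $L_n^{(\alpha)}$ denotes the Laguerre polynomial of degree $n$ in the standard (Szegő) normalization: it is orthogonal with respect to $x^\alpha e^{-x}$ on $[0,\infty)$ and $L_n^{(\alpha)}(0)=\binom{n+\alpha}{n}$. *)

theory Defs
  imports "HOL-Analysis.Analysis" "HOL-Computational_Algebra.Polynomial"
begin

definition orthogonal_poly_seq :: "(real \<Rightarrow> real) \<Rightarrow> real set \<Rightarrow> (nat \<Rightarrow> real poly) \<Rightarrow> bool" where
  "orthogonal_poly_seq w A P \<longleftrightarrow>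
     (\<forall>n. degree (P n) = n) \<and>
     (\<forall>m n. m \<noteq> n \<longrightarrow> (LINT x:A|lborel. poly (P m) x * poly (P n) x * w x) = 0)"

(* The descriptions below denote the classical sequences when all parameters exceed -1: the weight
   then has finite moments, the orthogonal sequence is unique up to scaling each member, and no
   member vanishes at the normalization point. Since "0 powr a = 0" also for "a \<le> 0", the
   formal weights may differ from the intended ones at the end points of the interval, which form
   a null set. *)

definition jacobi_poly :: "real \<Rightarrow> real \<Rightarrow> nat \<Rightarrow> real poly" where
  "jacobi_poly \<alpha> \<beta> =
     (THE P. orthogonal_poly_seq (\<lambda>x. (1 - x) powr \<alpha> * (1 + x) powr \<beta>) {-1..1} P \<and>
             (\<forall>n. poly (P n) 1 = (real n + \<alpha>) gchoose n))"

definition laguerre_poly :: "real \<Rightarrow> nat \<Rightarrow> real poly" where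
  "laguerre_poly \<alpha> =
     (THE P. orthogonal_poly_seq (\<lambda>x. x powr \<alpha> * exp (- x)) {0..} P \<and>
             (\<forall>n. poly (P n) 0 = (real n + \<alpha>) gchoose n))"

end

theory Submission
  imports Defs
begin

text \<open>
  Both inequalities are instances of the Cauchy--Schwarz inequality in Engel form,
  $(X + Y)^2 / (X_0 + Y_0) \<le> X^2 / X_0 + Y^2 / Y_0$ for positive $X_0, Y_0$. The decomposition
  $X + Y$ comes from the contiguous relations
  \[ (n+\alpha+\beta+1) P_n^{(\alpha+1,\beta)} =
       (2n+\alpha+\beta+1) P_n^{(\alpha,\beta)} + (n+\beta) P_{n-1}^{(\alpha+1,\beta)},
     \qquad L_n^{(\alpha+1)} = L_n^{(\alpha)} + L_{n-1}^{(\alpha+1)}, \]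
  whose coefficients are all positive. Read at the argument $x$ they give the numerators, and read
  at the normalization point ($1$ and $0$ respectively), where every polynomial involved is
  positive, they give the denominators.

  The contiguous relations are compared coefficientwise in the explicit sums in powers of
  $(1-x)/2$ and of $x$ (\<open>hyper_poly_contiguous\<close>). What takes most of the work is that these sums are
  the sequences that are described by orthogonality and normalization. That such a sequence is
  unique is a general fact about positive weights with finite moments
  (\<open>the_orthogonal_poly_seq_eq\<close>). That the explicit sums are orthogonal follows by integrating the
  $n$-th one against $(1+x)^j$ or $x^j$ with $j < n$, one for each degree: the Beta and Gamma
  integrals turn the result into an $n$-th finite difference of a polynomial of degree less than
  $n$, which is $0$ (\<open>sum_alternating_binomial_pochhammer_eq_0\<close>).
\<close>

section \<open>Polynomials orthogonal with respect to a weight\<close>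

text \<open>Polynomials of degree less than \<open>n\<close> are spanned by any family with one member of each degree
  below \<open>n\<close>; as an induction rule, this carries linear properties from the family to all of them.
  The bound is put on the coefficients, since the zero polynomial also has degree \<open>0\<close>.\<close>
lemma graded_poly_induct [consumes 2, case_names zero step]:
  fixes B :: "nat \<Rightarrow> 'a::field poly"
  assumes "\<And>j. degree (B j) = j \<and> B j \<noteq> 0" and "\<forall>i\<ge>n. coeff p i = 0"
    and "Q 0" and "\<And>r c j. j < n \<Longrightarrow> Q r \<Longrightarrow> Q (r + smult c (B j))"
  shows "Q p"
  using assms(2,4)
proof (induction n arbitrary: p)
  case 0
  then have "p = 0" by (simp add: poly_eq_iff)
  with \<open>Q 0\<close> show ?case by simp
next
  case (Suc n)
  define c where "c = coeff p n / lead_coeff (B n)"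
  have "\<forall>i\<ge>n. coeff (p - smult c (B n)) i = 0"
  proof (intro allI impI)
    fix i assume "n \<le> i"
    show "coeff (p - smult c (B n)) i = 0"
    proof (cases "i = n")
      case True
      with assms(1)[of n] show ?thesis
        by (auto simp: c_def simp flip: leading_coeff_0_iff)
    next
      case False
      with \<open>n \<le> i\<close> Suc.prems(1) assms(1)[of n] show ?thesis by (simp add: coeff_eq_0)
    qed
  qed
  then have "Q (p - smult c (B n))"
    by (rule Suc.IH) (use Suc.prems(2) in auto)
  then have "Q (p - smult c (B n) + smult c (B n))"
    by (rule Suc.prems(2)[rotated]) simp
  then show ?case by simp
qed

lemma set_integrable_poly_weight:
  fixes B :: "nat \<Rightarrow> real poly"
  assumes "\<And>j. degree (B j) = j \<and> B j \<noteq> 0"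
    and "\<And>j. set_integrable lborel A (\<lambda>x. poly (B j) x * w x)"
  shows "set_integrable lborel A (\<lambda>x. poly p x * w x)"
proof -
  have "\<forall>i\<ge>Suc (degree p). coeff p i = 0" by (simp add: coeff_eq_0)
  with assms(1) show ?thesis
  proof (induction rule: graded_poly_induct)
    case zero
    show ?case by (simp add: set_integrable_def)
  next
    case (step r c j)
    then show ?case
      using assms(2)[of j] by (simp add: distrib_right mult.assoc set_integral_add(1))
  qed
qed

text \<open>The weight may vanish on part of \<open>A\<close> (the Jacobi weights do at the end points, for instance);
  positivity on some open interval is enough to make the inner product definite.\<close>
locale polynomial_weight =
  fixes w :: "real \<Rightarrow> real" and A :: "real set" and a b :: real
  assumes weight_nonneg: "x \<in> A \<Longrightarrow> 0 \<le> w x"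
    and weight_pos: "a < x \<Longrightarrow> x < b \<Longrightarrow> 0 < w x"
    and interval: "a < b" "{a<..<b} \<subseteq> A"
    and weight_integrable: "set_integrable lborel A (\<lambda>x. poly p x * w x)"
begin

definition wint :: "real poly \<Rightarrow> real" where
  "wint p = (LINT x:A|lborel. poly p x * w x)"

lemma wint_0 [simp]: "wint 0 = 0"
  by (simp add: wint_def set_lebesgue_integral_def)

lemma wint_add: "wint (p + q) = wint p + wint q"
  using weight_integrable by (simp add: wint_def distrib_right)

lemma wint_smult: "wint (smult c p) = c * wint p"
  by (simp add: wint_def mult.assoc)

lemma wint_sum: "wint (sum f S) = (\<Sum>i\<in>S. wint (f i))"
  by (induction S rule: infinite_finite_induct) (simp_all add: wint_add)

lemma orthogonal_poly_seq_iff: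
  "orthogonal_poly_seq w A P \<longleftrightarrow>
     (\<forall>n. degree (P n) = n) \<and> (\<forall>m n. m \<noteq> n \<longrightarrow> wint (P m * P n) = 0)"
  by (simp add: orthogonal_poly_seq_def wint_def)

lemma wint_eq_0_if_orthogonal_to_basis:
  assumes "\<And>j. degree (B j) = j \<and> B j \<noteq> 0" and "\<forall>i\<ge>n. coeff p i = 0"
    and "\<And>j. j < n \<Longrightarrow> wint (q * B j) = 0"
  shows "wint (q * p) = 0"
  using assms(1,2)
  by (induction rule: graded_poly_induct)
     (simp_all add: distrib_left wint_add wint_smult assms(3))

text \<open>A nonzero polynomial has finitely many roots, so its square is positive almost everywhere on the
  interval on which the weight is positive.\<close>
lemma wint_square_eq_0D:
  assumes "wint (p * p) = 0"
  shows "p = 0"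
proof (rule ccontr)
  assume "p \<noteq> 0"
  then have "finite {x. poly p x = 0}" by (rule poly_roots_finite)
  then have roots: "AE x in lborel. x \<notin> {x. poly p x = 0}"
    by (intro AE_not_in finite_imp_null_set_lborel)
  have "AE x in lborel. indicator A x *\<^sub>R (poly (p * p) x * w x) = 0"
  proof (subst integral_nonneg_eq_0_iff_AE [symmetric])
    show "integrable lborel (\<lambda>x. indicator A x *\<^sub>R (poly (p * p) x * w x))"
      using weight_integrable[of "p * p"] by (simp only: set_integrable_def)
    show "AE x in lborel. 0 \<le> indicator A x *\<^sub>R (poly (p * p) x * w x)"
      by (auto simp: weight_nonneg indicator_def)
    show "(LINT x|lborel. indicator A x *\<^sub>R (poly (p * p) x * w x)) = 0"
      using assms by (simp only: wint_def set_lebesgue_integral_def)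
  qed
  with roots have "AE x in lborel. x \<notin> {a<..<b}"
  proof eventually_elim
    case (elim x)
    show ?case
    proof
      assume "x \<in> {a<..<b}"
      with elim weight_pos[of x] interval(2) show False by auto
    qed
  qed
  then have "{a<..<b} \<in> null_sets lborel"
    by (subst (asm) AE_iff_null_sets [symmetric]) simp_all
  with interval(1) show False by auto
qed

text \<open>With \<open>c\<close> the quotient of the leading coefficients, \<open>r = P n - c * Q n\<close> has degree less than
  \<open>n\<close>. Either sequence spans these degrees, hence both \<open>P n\<close> and \<open>Q n\<close> are orthogonal to
  \<open>r\<close>. So \<open>r\<close> is orthogonal to itself and vanishes, and the common nonzero value at \<open>z\<close>
  forces \<open>c = 1\<close>.\<close>
lemma orthogonal_poly_seq_unique:
  assumes P: "orthogonal_poly_seq w A P" and Q: "orthogonal_poly_seq w A Q"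
    and eq: "\<And>n. poly (P n) z = poly (Q n) z" and nz: "\<And>n. poly (Q n) z \<noteq> 0"
  shows "P = Q"
proof
  fix n
  have P_nz: "P n \<noteq> 0" for n using eq[of n] nz[of n] by auto
  have Q_nz: "Q n \<noteq> 0" for n using nz[of n] by auto
  define c where "c = lead_coeff (P n) / lead_coeff (Q n)"
  define r where "r = P n - smult c (Q n)"
  have low: "\<forall>i\<ge>n. coeff r i = 0"
  proof (intro allI impI)
    fix i assume "n \<le> i"
    moreover have "degree (P n) = n" "degree (Q n) = n"
      using P Q by (simp_all add: orthogonal_poly_seq_iff)
    moreover have "lead_coeff (Q n) \<noteq> 0" using Q_nz[of n] by simp
    ultimately show "coeff r i = 0"
      by (cases "i = n") (auto simp: r_def c_def coeff_eq_0)
  qed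
  have "wint (P n * r) = 0"
    by (rule wint_eq_0_if_orthogonal_to_basis[OF _ low, where B = P])
       (use P P_nz in \<open>auto simp: orthogonal_poly_seq_iff\<close>)
  moreover have "wint (Q n * r) = 0"
    by (rule wint_eq_0_if_orthogonal_to_basis[OF _ low, where B = Q])
       (use Q Q_nz in \<open>auto simp: orthogonal_poly_seq_iff\<close>)
  moreover have "r * r = P n * r + smult (- c) (Q n * r)"
    by (simp add: r_def algebra_simps smult_diff_right)
  ultimately have "wint (r * r) = 0"
    by (simp only: wint_add wint_smult)
  then have "r = 0" by (rule wint_square_eq_0D)
  then have *: "P n = smult c (Q n)" by (simp add: r_def)
  with eq[of n] nz[of n] have "c = 1" by simp
  with * show "P n = Q n" by simp
qed

text \<open>This reduces the identification of an orthogonal sequence to integrals against one test polynomial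
  \<open>B j\<close> of each lower degree, which can be chosen to make the integrals easy.\<close>
lemma the_orthogonal_poly_seq_eq:
  assumes deg: "\<And>n. degree (Q n) = n"
    and B: "\<And>j. degree (B j) = j \<and> B j \<noteq> 0"
    and orth: "\<And>n j. j < n \<Longrightarrow> wint (Q n * B j) = 0"
    and val: "\<And>n. poly (Q n) z = v n" and nz: "\<And>n. v n \<noteq> 0"
  shows "(THE P. orthogonal_poly_seq w A P \<and> (\<forall>n. poly (P n) z = v n)) = Q"
proof (rule the_equality)
  have lower: "wint (Q n * Q m) = 0" if "m < n" for m n
    by (rule wint_eq_0_if_orthogonal_to_basis[OF B, where n = n])
       (use that orth deg in \<open>auto simp: coeff_eq_0\<close>)
  have "wint (Q m * Q n) = 0" if "m \<noteq> n" for m n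
    using that lower[of m n] lower[of n m] by (cases "m < n") (auto simp: mult.commute)
  with deg have "orthogonal_poly_seq w A Q" by (simp add: orthogonal_poly_seq_iff)
  with val show *: "orthogonal_poly_seq w A Q \<and> (\<forall>n. poly (Q n) z = v n)" by simp
  fix P assume "orthogonal_poly_seq w A P \<and> (\<forall>n. poly (P n) z = v n)"
  with * nz show "P = Q" by (intro orthogonal_poly_seq_unique[where z = z]) auto
qed

end

section \<open>Moments of the two weights\<close>

text \<open>Euler's integrals are stated for the gauge integral; for nonnegative integrands they are Lebesgue
  integrals as well.\<close>
lemma set_lborel_integral_nonneg:
  fixes f :: "real \<Rightarrow> real"
  assumes "f \<in> borel_measurable borel" "A \<in> sets borel"
    and "\<And>x. x \<in> A \<Longrightarrow> 0 \<le> f x" and "(f has_integral c) A" and "0 \<le> c"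
  shows "set_integrable lborel A f" "(LINT x:A|lborel. f x) = c"
proof -
  have "has_bochner_integral lborel (\<lambda>x. indicator A x *\<^sub>R f x) c"
  proof (rule has_bochner_integral_nn_integral)
    show "(\<lambda>x. indicator A x *\<^sub>R f x) \<in> borel_measurable lborel"
      using assms(1,2) by simp
    show "AE x in lborel. 0 \<le> indicator A x *\<^sub>R f x"
      using assms(3) by (auto simp: indicator_def)
    show "(\<integral>\<^sup>+ x. ennreal (indicator A x *\<^sub>R f x) \<partial>lborel) = ennreal c"
      using nn_integral_has_integral_lebesgue[OF assms(3,4)] by simp
  qed fact
  then show "set_integrable lborel A f" "(LINT x:A|lborel. f x) = c"
    by (simp_all add: set_integrable_def set_lebesgue_integral_def has_bochner_integral_iff)
qed

text \<open>The convention \<open>0 powr a = 0\<close> makes this hold at \<open>x = 0\<close> too, even for \<open>k = 0\<close> or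
  nonpositive exponents.\<close>
lemma power_mult_powr:
  fixes x :: real
  assumes "0 \<le> x"
  shows "x ^ k * x powr a = x powr (a + real k)"
  using assms by (cases "x = 0") (auto simp: powr_add powr_realpow)

lemma Gamma_has_integral:
  assumes "\<alpha> > -1"
  shows "((\<lambda>x. x ^ k * (x powr \<alpha> * exp (- x))) has_integral Gamma (\<alpha> + real k + 1)) {0..}"
proof (rule has_integral_eq[rotated])
  show "((\<lambda>t. t powr (\<alpha> + real k + 1 - 1) / exp t) has_integral Gamma (\<alpha> + real k + 1)) {0..}"
    using assms by (intro Gamma_integral_real) auto
  show "x powr (\<alpha> + real k + 1 - 1) / exp x = x ^ k * (x powr \<alpha> * exp (- x))"
    if "x \<in> {0..}" for x
    using that by (simp add: power_mult_powr exp_minus field_simps flip: mult.assoc)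
qed

text \<open>Both linear factors are halved, so that the substitution \<open>t = (1 + x) / 2\<close> from the unit
  interval leaves a power of \<open>2\<close> that depends on neither \<open>k\<close> nor \<open>j\<close>.\<close>
lemma Beta_has_integral:
  assumes "\<alpha> > -1" "\<beta> > -1"
  shows "((\<lambda>x. ((1 - x) / 2) ^ k * ((1 + x) / 2) ^ j * ((1 - x) powr \<alpha> * (1 + x) powr \<beta>))
    has_integral 2 powr (\<alpha> + \<beta> + 1) * Beta (\<alpha> + real k + 1) (\<beta> + real j + 1)) {-1..1}"
proof (rule has_integral_eq[rotated])
  define f where "f = (\<lambda>t. t powr (\<beta> + real j) * (1 - t) powr (\<alpha> + real k))"
  have "(f has_integral Beta (\<beta> + real j + 1) (\<alpha> + real k + 1)) (cbox 0 1)"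
    using has_integral_Beta_real[of "\<beta> + real j + 1" "\<alpha> + real k + 1"] assms
    by (simp add: f_def)
  from has_integral_affinity'[OF this, of "1/2" "1/2"]
  have "((\<lambda>x. f (x / 2 + 1 / 2)) has_integral
          2 * Beta (\<alpha> + real k + 1) (\<beta> + real j + 1)) {-1..1}"
    by (simp add: Beta_commute)
  from has_integral_mult_right[OF this, of "2 powr (\<alpha> + \<beta>)"]
  show "((\<lambda>x. 2 powr (\<alpha> + \<beta>) * f (x / 2 + 1 / 2)) has_integral
          2 powr (\<alpha> + \<beta> + 1) * Beta (\<alpha> + real k + 1) (\<beta> + real j + 1)) {-1..1}"
    by (simp add: powr_add mult_ac)
  fix x :: real assume x: "x \<in> {-1..1}"
  define u v where "u = (1 - x) / 2" and "v = (1 + x) / 2"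
  have uv: "0 \<le> u" "0 \<le> v" "1 - x = 2 * u" "1 + x = 2 * v" "x / 2 + 1 / 2 = v" "1 - v = u"
    using x by (auto simp: u_def v_def field_simps)
  show "2 powr (\<alpha> + \<beta>) * f (x / 2 + 1 / 2) =
      ((1 - x) / 2) ^ k * ((1 + x) / 2) ^ j * ((1 - x) powr \<alpha> * (1 + x) powr \<beta>)"
    unfolding uv f_def powr_add[of 2] power_mult_powr[OF uv(1), symmetric]
      power_mult_powr[OF uv(2), symmetric]
    using uv(1,2) by (simp add: powr_mult)
qed

text \<open>Up to sign, the sum is the \<open>n\<close>-th finite difference, with step \<open>1\<close>, of the polynomial
  \<open>x \<mapsto> pochhammer x m\<close> of degree \<open>m\<close>. One difference turns it into \<open>m\<close> times a shifted
  Pochhammer symbol of degree \<open>m - 1\<close>, which drives the induction.\<close>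
lemma sum_alternating_binomial_pochhammer_eq_0:
  fixes c :: "'a::comm_ring_1"
  assumes "m < n"
  shows "(\<Sum>k\<le>n. (-1) ^ k * of_nat (n choose k) * pochhammer (c + of_nat k) m) = 0"
  using assms
proof (induction n arbitrary: m c)
  case (Suc n)
  let ?S = "\<lambda>n m c. \<Sum>k\<le>n. (-1) ^ k * of_nat (n choose k) * pochhammer (c + of_nat k) m"
  \<comment> \<open>Pascal's rule writes an \<open>(n + 1)\<close>-st difference as a difference of two \<open>n\<close>-th ones.\<close>
  have "?S (Suc n) m c = ?S n m c - ?S n m (c + 1)" for c :: 'a
  proof -
    have "?S (Suc n) m c = pochhammer c m +
        (\<Sum>k\<le>n. (-1) ^ Suc k * of_nat (Suc n choose Suc k) * pochhammer (c + of_nat (Suc k)) m)"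
      by (subst sum.atMost_Suc_shift) simp
    also have "\<dots> = (pochhammer c m +
        (\<Sum>k\<le>n. (-1) ^ Suc k * of_nat (n choose Suc k) * pochhammer (c + of_nat (Suc k)) m))
        - ?S n m (c + 1)"
      by (simp add: algebra_simps sum.distrib sum_subtractf sum_negf)
    also have "pochhammer c m +
        (\<Sum>k\<le>n. (-1) ^ Suc k * of_nat (n choose Suc k) * pochhammer (c + of_nat (Suc k)) m)
        = (\<Sum>k\<le>Suc n. (-1) ^ k * of_nat (n choose k) * pochhammer (c + of_nat k) m)"
      by (subst sum.atMost_Suc_shift) simp
    also have "\<dots> = ?S n m c" by (simp add: binomial_eq_0)
    finally show ?thesis .
  qed
  moreover have "?S n m c - ?S n m (c + 1) = 0" for c :: 'a
  proof (cases m)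
    case 0
    then show ?thesis by simp
  next
    case m: (Suc l)
    have diff: "pochhammer x m - pochhammer (x + 1) m = - of_nat m * pochhammer (x + 1) l" for x :: 'a
    proof -
      have "pochhammer x m = x * pochhammer (x + 1) l" unfolding m by (rule pochhammer_rec)
      moreover have "pochhammer (x + 1) m = (x + 1 + of_nat l) * pochhammer (x + 1) l"
        unfolding m by (rule pochhammer_rec')
      ultimately show ?thesis by (simp add: m algebra_simps)
    qed
    have *: "pochhammer (c + of_nat k) m - pochhammer (c + 1 + of_nat k) m =
        - of_nat m * pochhammer (c + 1 + of_nat k) l" for k
      using diff[of "c + of_nat k"] by (simp add: add_ac)
    have "?S n m c - ?S n m (c + 1) =
        (\<Sum>k\<le>n. (-1) ^ k * of_nat (n choose k) * (- of_nat m * pochhammer (c + 1 + of_nat k) l))"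
      unfolding * [symmetric] by (simp only: right_diff_distrib sum_subtractf)
    also have "\<dots> = - of_nat m * ?S n l (c + 1)"
      by (simp only: sum_distrib_left mult_ac)
    also have "?S n l (c + 1) = 0" using Suc m by simp
    finally show ?thesis by simp
  qed
  ultimately show ?case by simp
qed simp

section \<open>Terminating hypergeometric sums\<close>

text \<open>With \<open>d = (\<lambda>_. 1)\<close> and \<open>u = x\<close> this is the Laguerre polynomial, a multiple of
  ${}_1F_1(-n; \alpha+1; x)$; with \<open>d\<close> the Pochhammer symbols of $n+\alpha+\beta+1$ and
  \<open>u = (1 - x) / 2\<close> it is the Jacobi polynomial, a multiple of
  ${}_2F_1(-n, n+\alpha+\beta+1; \alpha+1; (1-x)/2)$. The denominators $(\alpha+1)_k$ of these series
  are cleared against the factor $(\alpha+1)_n$ of the normalization, leaving $(\alpha+k+1)_{n-k}$.\<close>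
definition hyper_poly :: "real poly \<Rightarrow> (nat \<Rightarrow> real) \<Rightarrow> real \<Rightarrow> nat \<Rightarrow> real poly" where
  "hyper_poly u d \<alpha> n =
     (\<Sum>k\<le>n. smult ((-1) ^ k * real (n choose k) * pochhammer (\<alpha> + real k + 1) (n - k) / fact n * d k)
               (u ^ k))"

lemma degree_hyper_poly:
  assumes "degree u = 1" "d n \<noteq> 0"
  shows "degree (hyper_poly u d \<alpha> n) = n"
proof (rule antisym)
  have deg: "degree (u ^ k) = k" for k
    using assms(1) by (subst degree_power_eq) auto
  then show "degree (hyper_poly u d \<alpha> n) \<le> n"
    unfolding hyper_poly_def
    by (intro degree_sum_le) (auto intro: order.trans[OF degree_smult_le])
  have "coeff (hyper_poly u d \<alpha> n) n = (-1) ^ n / fact n * d n * coeff (u ^ n) n"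
    unfolding hyper_poly_def coeff_sum
    by (subst sum.remove[of _ n]) (auto intro!: sum.neutral coeff_eq_0 simp: deg)
  moreover have "coeff (u ^ n) n \<noteq> 0"
    using assms(1) deg[of n] by (metis degree_0 leading_coeff_0_iff power_not_zero zero_neq_one)
  ultimately show "n \<le> degree (hyper_poly u d \<alpha> n)"
    using assms(2) by (intro le_degree) simp
qed

lemma poly_hyper_poly_root:
  assumes "poly u z = 0" "d 0 = 1"
  shows "poly (hyper_poly u d \<alpha> n) z = (real n + \<alpha>) gchoose n"
proof -
  have "poly (hyper_poly u d \<alpha> n) z = pochhammer (\<alpha> + 1) n / fact n"
    unfolding hyper_poly_def poly_sum
    by (subst sum.remove[of _ 0]) (auto simp: assms intro!: sum.neutral)
  then show ?thesis by (simp add: gbinomial_pochhammer' algebra_simps)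
qed

lemma gbinomial_shift_pos:
  fixes \<alpha> :: real
  assumes "\<alpha> > -1"
  shows "(real n + \<alpha>) gchoose n > 0"
  using assms by (simp add: gbinomial_pochhammer' pochhammer_pos)

lemma smult_sum_right: "smult c (sum f S) = (\<Sum>i\<in>S. smult c (f i))"
  by (induction S rule: infinite_finite_induct) (simp_all add: smult_add_right)

text \<open>For \<open>k < n\<close> the coefficients of \<open>u ^ k\<close> in the three sums have a common factor (\<open>Y\<close> in the
  proof); what remains after dividing by it is exactly the assumption on \<open>d\<close>, \<open>d'\<close> and
  \<open>d''\<close>.\<close>
lemma hyper_poly_contiguous:
  assumes rel: "\<And>k. k \<le> n \<Longrightarrow>
      K * (\<alpha> + real k + 1) * d k = M * (\<alpha> + real n + 1) * d' k - N * (real n - real k) * d'' k"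
    and "n \<ge> 1" "\<alpha> > -1"
  shows "smult K (hyper_poly u d \<alpha> n) =
    smult M (hyper_poly u d' (\<alpha> + 1) n) - smult N (hyper_poly u d'' (\<alpha> + 1) (n - 1))"
proof -
  obtain m where n: "n = Suc m" using \<open>n \<ge> 1\<close> by (cases n) auto
  define p where "p k = (-1) ^ k * real (n choose k) * pochhammer (\<alpha> + real k + 1) (n - k)
    / fact n * d k" for k
  define p' where "p' k = (-1) ^ k * real (n choose k) * pochhammer (\<alpha> + 1 + real k + 1) (n - k)
    / fact n * d' k" for k
  define p'' where "p'' k = (-1) ^ k * real (m choose k) * pochhammer (\<alpha> + 1 + real k + 1) (m - k)
    / fact m * d'' k" for k
  have "K * p k = M * p' k - N * p'' k" if "k \<le> n" for k
  proof (cases "k = n")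
    \<comment> \<open>The last sum has no term in degree \<open>n\<close>, and in the first two the Pochhammer symbols
      of length \<open>n - k\<close> are empty; the assumption has to be divided by \<open>\<alpha> + n + 1 > 0\<close>.\<close>
    case True
    have "(\<alpha> + real n + 1) * (K * d n) = (\<alpha> + real n + 1) * (M * d' n)"
      using rel[of n] by (simp add: mult_ac)
    with \<open>\<alpha> > -1\<close> have "K * d n = M * d' n" by simp
    from arg_cong[OF this, of "\<lambda>t. (-1) ^ n / fact n * t"] True show ?thesis
      by (simp add: n p_def p'_def p''_def binomial_eq_0 algebra_simps)
  next
    case False
    with that have k: "n - k = Suc (m - k)" "k \<le> m" by (auto simp: n)
    define X where "X = pochhammer (\<alpha> + 1 + real k + 1) (m - k)"
    define Y where "Y = (-1) ^ k * real (n choose k) * X / fact n"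
    have "pochhammer (\<alpha> + real k + 1) (n - k) = (\<alpha> + real k + 1) * X"
      unfolding k X_def by (subst pochhammer_rec) (simp add: add_ac)
    then have 1: "K * p k = Y * (K * (\<alpha> + real k + 1) * d k)"
      by (simp add: p_def Y_def)
    have "pochhammer (\<alpha> + 1 + real k + 1) (n - k) = (\<alpha> + real n + 1) * X"
      unfolding k X_def by (subst pochhammer_rec') (use k(2) in \<open>simp add: n add_ac of_nat_diff\<close>)
    then have 2: "M * p' k = Y * (M * (\<alpha> + real n + 1) * d' k)"
      by (simp add: p'_def Y_def)
    have "(n - k) * (n choose k) = n * (m choose k)"
      using binomial_absorb_comp[of n k] by (simp add: n)
    then have absorb: "real n * real (m choose k) = (real n - real k) * real (n choose k)"
      using that by (metis of_nat_diff of_nat_mult)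
    have "real (m choose k) / fact m = real n * real (m choose k) / fact n"
      by (simp add: n del: of_nat_Suc)
    then have "real (m choose k) / fact m = (real n - real k) * real (n choose k) / fact n"
      by (simp only: absorb)
    moreover have "p'' k = (real (m choose k) / fact m) * ((-1) ^ k * X * d'' k)"
      by (simp add: p''_def X_def)
    ultimately have 3: "N * p'' k = Y * (N * (real n - real k) * d'' k)"
      by (simp add: Y_def)
    show ?thesis unfolding 1 2 3 rel[OF that] by (simp only: right_diff_distrib)
  qed
  then have "(\<Sum>k\<le>n. smult (K * p k) (u ^ k)) = (\<Sum>k\<le>n. smult (M * p' k - N * p'' k) (u ^ k))"
    by simp
  also have "\<dots> = smult M (\<Sum>k\<le>n. smult (p' k) (u ^ k)) - smult N (\<Sum>k\<le>n. smult (p'' k) (u ^ k))"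
    by (simp add: smult_sum_right smult_diff_left sum_subtractf)
  also have "(\<Sum>k\<le>n. smult (p'' k) (u ^ k)) = hyper_poly u d'' (\<alpha> + 1) (n - 1)"
    by (simp add: hyper_poly_def p''_def n)
  finally show ?thesis
    by (simp add: hyper_poly_def p_def p'_def smult_sum_right)
qed

section \<open>Jacobi polynomials\<close>

abbreviation jacobi_sum :: "real \<Rightarrow> real \<Rightarrow> nat \<Rightarrow> real poly" where
  "jacobi_sum \<alpha> \<beta> n \<equiv> hyper_poly [:1/2, -1/2:] (pochhammer (real n + \<alpha> + \<beta> + 1)) \<alpha> n"

text \<open>Both sides are $\Gamma(s+m+k) / (\Gamma(s+m)\,\Gamma(s+k))$. The right-hand side shows that the
  dependence on \<open>k\<close> is polynomial of degree \<open>m\<close>.\<close>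
lemma pochhammer_div_Gamma_swap:
  fixes s :: real
  assumes "s > 0"
  shows "pochhammer (s + real m) k / Gamma (s + real k) = pochhammer (s + real k) m / Gamma (s + real m)"
proof -
  have "pochhammer (s + real m) k = Gamma (s + real m + real k) / Gamma (s + real m)"
    "pochhammer (s + real k) m = Gamma (s + real k + real m) / Gamma (s + real k)"
    using assms by (intro pochhammer_Gamma; force simp: nonpos_Ints_def)+
  then show ?thesis by (simp add: add_ac)
qed

text \<open>The sum in powers of $u = (1-x)/2$ is tested against powers of $v = (1+x)/2$, since then every term
  is a single Beta integral. Its factor $\Gamma(\alpha+k+1)$ completes $(\alpha+k+1)_{n-k}$ to
  $\Gamma(\alpha+n+1)$, and the quotient of $(n+\alpha+\beta+1)_k$ by the Gamma value in the
  denominator is a polynomial in \<open>k\<close> of degree $n-1-j$, so an \<open>n\<close>-th difference annihilates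
  it.\<close>
lemma jacobi_poly_eq:
  assumes \<alpha>: "\<alpha> > -1" and \<beta>: "\<beta> > -1"
  shows "jacobi_poly \<alpha> \<beta> = jacobi_sum \<alpha> \<beta>"
proof -
  define w where "w = (\<lambda>x::real. (1 - x) powr \<alpha> * (1 + x) powr \<beta>)"
  have w: "w x = (1 - x) powr \<alpha> * (1 + x) powr \<beta>" for x by (simp add: w_def)
  define u v where "u = [:1/2, -1/2::real:]" and "v = [:1/2, 1/2::real:]"
  have v: "degree (v ^ j) = j \<and> v ^ j \<noteq> 0" for j
    by (subst degree_power_eq) (auto simp: v_def)
  have uv: "poly (u ^ k * v ^ j) x = ((1 - x) / 2) ^ k * ((1 + x) / 2) ^ j" for k j x
    by (simp add: u_def v_def add_divide_distrib diff_divide_distrib)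
  note moments = set_lborel_integral_nonneg[OF _ _ _ Beta_has_integral[OF \<alpha> \<beta>],
      folded uv, folded w]
  have moment: "set_integrable lborel {-1..1} (\<lambda>x. poly (u ^ k * v ^ j) x * w x)"
    "(LINT x:{-1..1}|lborel. poly (u ^ k * v ^ j) x * w x) =
        2 powr (\<alpha> + \<beta> + 1) * Beta (\<alpha> + real k + 1) (\<beta> + real j + 1)" for k j
  proof -
    have "w \<in> borel_measurable borel" unfolding w_def by measurable
    then have meas: "(\<lambda>x. poly (u ^ k * v ^ j) x * w x) \<in> borel_measurable borel"
      unfolding uv by measurable
    have nn_moment: "0 \<le> 2 powr (\<alpha> + \<beta> + 1) * Beta (\<alpha> + real k + 1) (\<beta> + real j + 1)"
      using \<alpha> \<beta> by (simp add: Beta_def)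
    have nn: "0 \<le> poly (u ^ k * v ^ j) x * w x" if "x \<in> {-1..1}" for x
      unfolding uv w_def using that by (intro mult_nonneg_nonneg zero_le_power) auto
    show "set_integrable lborel {-1..1} (\<lambda>x. poly (u ^ k * v ^ j) x * w x)"
      by (rule moments(1)[OF meas _ nn nn_moment], simp)
    show "(LINT x:{-1..1}|lborel. poly (u ^ k * v ^ j) x * w x) =
        2 powr (\<alpha> + \<beta> + 1) * Beta (\<alpha> + real k + 1) (\<beta> + real j + 1)"
      by (rule moments(2)[OF meas _ nn nn_moment], simp)
  qed
  interpret polynomial_weight w "{-1..1}" "-1" 1
  proof
    show "set_integrable lborel {-1..1} (\<lambda>x. poly p x * w x)" for p
      by (rule set_integrable_poly_weight[OF v]) (use moment(1)[of 0] in simp)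
  qed (auto simp: w_def)
  have "wint (jacobi_sum \<alpha> \<beta> n * v ^ j) = 0" if "j < n" for n j
  proof -
    \<comment> \<open>Chosen so that the moments have \<open>Gamma (s + k)\<close> in the denominator, while
      \<open>s + m = n + \<alpha> + \<beta> + 1\<close>.\<close>
    define m where "m = n - 1 - j"
    define s where "s = \<alpha> + \<beta> + real j + 2"
    have s: "s > 0" "real n + \<alpha> + \<beta> + 1 = s + real m"
      using that \<alpha> \<beta> by (auto simp: s_def m_def of_nat_diff)
    define C where "C = 2 powr (\<alpha> + \<beta> + 1) * Gamma (\<beta> + real j + 1) * Gamma (\<alpha> + real n + 1)
        / Gamma (s + real m) / fact n"
    have "wint (jacobi_sum \<alpha> \<beta> n * v ^ j) =
       (\<Sum>k\<le>n. (-1) ^ k * real (n choose k) * pochhammer (\<alpha> + real k + 1) (n - k) / fact n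
          * pochhammer (s + real m) k * wint (u ^ k * v ^ j))"
      unfolding u_def [symmetric] s(2)
      by (simp add: hyper_poly_def sum_distrib_right wint_sum wint_smult)
    also have "\<dots> = (\<Sum>k\<le>n. C * ((-1) ^ k * real (n choose k) * pochhammer (s + real k) m))"
    proof (intro sum.cong refl)
      fix k assume "k \<in> {..n}"
      then have k: "k \<le> n" by simp
      have "pochhammer (\<alpha> + real k + 1) (n - k)
          = Gamma (\<alpha> + real k + 1 + real (n - k)) / Gamma (\<alpha> + real k + 1)"
        using \<alpha> by (intro pochhammer_Gamma) (force simp: nonpos_Ints_def)
      also have "\<alpha> + real k + 1 + real (n - k) = \<alpha> + real n + 1"
        using k by (simp add: of_nat_diff)
      finally have "pochhammer (\<alpha> + real k + 1) (n - k)
          = Gamma (\<alpha> + real n + 1) / Gamma (\<alpha> + real k + 1)" .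
      moreover have "Gamma (\<alpha> + real k + 1) > 0" using \<alpha> by (intro Gamma_real_pos) simp
      ultimately have 1: "pochhammer (\<alpha> + real k + 1) (n - k) * Gamma (\<alpha> + real k + 1)
          = Gamma (\<alpha> + real n + 1)"
        by simp
      have "wint (u ^ k * v ^ j) = 2 powr (\<alpha> + \<beta> + 1) * Gamma (\<alpha> + real k + 1)
          * Gamma (\<beta> + real j + 1) / Gamma (s + real k)"
        unfolding wint_def moment(2) Beta_def by (simp add: s_def add_ac)
      then have "(-1) ^ k * real (n choose k) * pochhammer (\<alpha> + real k + 1) (n - k) / fact n
          * pochhammer (s + real m) k * wint (u ^ k * v ^ j) =
          (-1) ^ k * real (n choose k) / fact n * 2 powr (\<alpha> + \<beta> + 1) * Gamma (\<beta> + real j + 1)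
          * (pochhammer (\<alpha> + real k + 1) (n - k) * Gamma (\<alpha> + real k + 1))
          * (pochhammer (s + real m) k / Gamma (s + real k))"
        by simp
      also have "\<dots> = C * ((-1) ^ k * real (n choose k) * pochhammer (s + real k) m)"
        unfolding 1 pochhammer_div_Gamma_swap[OF s(1)] by (simp add: C_def mult_ac)
      finally show "(-1) ^ k * real (n choose k) * pochhammer (\<alpha> + real k + 1) (n - k) / fact n
          * pochhammer (s + real m) k * wint (u ^ k * v ^ j) = \<dots>" .
    qed
    also have "\<dots> = 0"
      using that
      by (simp only: sum_distrib_left [symmetric] sum_alternating_binomial_pochhammer_eq_0 m_def)
    finally show ?thesis .
  qed
  moreover have "degree (jacobi_sum \<alpha> \<beta> n) = n" for n
  proof (rule degree_hyper_poly)
    show "pochhammer (real n + \<alpha> + \<beta> + 1) n \<noteq> 0"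
    \<comment> \<open>For \<open>n = 0\<close> the base may be negative or zero, but the product is empty.\<close>
    proof (cases n)
      case (Suc m)
      with \<alpha> \<beta> have "real n + \<alpha> + \<beta> + 1 > 0" by simp
      from pochhammer_pos[OF this, of n] show ?thesis by simp
    qed simp
  qed simp
  moreover have "poly (jacobi_sum \<alpha> \<beta> n) 1 = (real n + \<alpha>) gchoose n" for n
    by (rule poly_hyper_poly_root) simp_all
  moreover have "(real n + \<alpha>) gchoose n \<noteq> 0" for n
    using gbinomial_shift_pos[OF \<alpha>, of n] by simp
  ultimately show ?thesis
    unfolding jacobi_poly_def w_def [symmetric]
    by (intro the_orthogonal_poly_seq_eq[OF _ v]) auto
qed

lemma jacobi_poly_at_1_pos:
  assumes "\<alpha> > -1" "\<beta> > -1"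
  shows "poly (jacobi_poly \<alpha> \<beta> n) 1 > 0"
  unfolding jacobi_poly_eq[OF assms]
  by (subst poly_hyper_poly_root) (simp_all add: gbinomial_shift_pos assms)

text \<open>With $p = n+\alpha+\beta+1$, the factors $(p+1)_k$ and $(p)_k$ of the two sequences for $\alpha+1$
  differ by $p\,(p+1)_k = (p+k)\,(p)_k$, after which the relation of the coefficients is the
  identity $(2n+\alpha+\beta+1)(\alpha+k+1) = (p+k)(\alpha+n+1) - (n+\beta)(n-k)$.\<close>
lemma jacobi_poly_contiguous:
  assumes "\<alpha> > -1" "\<beta> > -1" "n \<ge> 1"
  shows "smult (2 * real n + \<alpha> + \<beta> + 1) (jacobi_poly \<alpha> \<beta> n) =
     smult (real n + \<alpha> + \<beta> + 1) (jacobi_poly (\<alpha> + 1) \<beta> n)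
     - smult (real n + \<beta>) (jacobi_poly (\<alpha> + 1) \<beta> (n - 1))"
proof -
  have "\<alpha> + 1 > -1" using assms by simp
  note eqs = jacobi_poly_eq[OF assms(1,2)] jacobi_poly_eq[OF this assms(2)]
  define p where "p = real n + \<alpha> + \<beta> + 1"
  have params: "real (n - 1) + (\<alpha> + 1) + \<beta> + 1 = p" "real n + (\<alpha> + 1) + \<beta> + 1 = p + 1"
    using assms(3) by (simp_all add: p_def of_nat_diff)
  show ?thesis unfolding eqs params p_def [symmetric]
  proof (rule hyper_poly_contiguous)
    fix k
    have "p * pochhammer (p + 1) k = (p + real k) * pochhammer p k"
      by (metis pochhammer_rec pochhammer_rec')
    then have "p * (\<alpha> + real n + 1) * pochhammer (p + 1) k
        = (\<alpha> + real n + 1) * (p + real k) * pochhammer p k" by (simp add: mult_ac)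
    then show "(2 * real n + \<alpha> + \<beta> + 1) * (\<alpha> + real k + 1) * pochhammer p k =
        p * (\<alpha> + real n + 1) * pochhammer (p + 1) k
        - (real n + \<beta>) * (real n - real k) * pochhammer p k"
      by (simp add: p_def algebra_simps)
  qed (use assms in auto)
qed

section \<open>Laguerre polynomials\<close>

text \<open>Against $x^j$, the \<open>k\<close>-th term gives $\Gamma(\alpha+k+j+1)$. Together with
  $(\alpha+k+1)_{n-k}$ this is $\Gamma(\alpha+n+1)\,(\alpha+k+1)_j$, of degree $j < n$ in
  \<open>k\<close>.\<close>
lemma laguerre_poly_eq:
  assumes \<alpha>: "\<alpha> > -1"
  shows "laguerre_poly \<alpha> = hyper_poly [:0, 1:] (\<lambda>_. 1) \<alpha>"
proof -
  define w where "w = (\<lambda>x::real. x powr \<alpha> * exp (- x))"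
  have w: "w x = x powr \<alpha> * exp (- x)" for x by (simp add: w_def)
  define u where "u = [:0, 1::real:]"
  have u: "degree (u ^ j) = j \<and> u ^ j \<noteq> 0" for j
    by (subst degree_power_eq) (auto simp: u_def)
  have ux: "poly (u ^ k) x = x ^ k" for k x
    by (simp add: u_def)
  note moments = set_lborel_integral_nonneg[OF _ _ _ Gamma_has_integral[OF \<alpha>],
      folded ux, folded w]
  have moment: "set_integrable lborel {0..} (\<lambda>x. poly (u ^ k) x * w x)"
    "(LINT x:{0..}|lborel. poly (u ^ k) x * w x) = Gamma (\<alpha> + real k + 1)" for k
  proof -
    have "w \<in> borel_measurable borel" unfolding w_def by measurable
    then have meas: "(\<lambda>x. poly (u ^ k) x * w x) \<in> borel_measurable borel"
      unfolding ux by measurable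
    have nn: "0 \<le> poly (u ^ k) x * w x" if "x \<in> {0..}" for x
      unfolding ux w_def using that by simp
    have nn_moment: "0 \<le> Gamma (\<alpha> + real k + 1)"
      using \<alpha> by simp
    show "set_integrable lborel {0..} (\<lambda>x. poly (u ^ k) x * w x)"
      by (rule moments(1)[OF meas _ nn nn_moment], simp)
    show "(LINT x:{0..}|lborel. poly (u ^ k) x * w x) = Gamma (\<alpha> + real k + 1)"
      by (rule moments(2)[OF meas _ nn nn_moment], simp)
  qed
  interpret polynomial_weight w "{0..}" 0 1
  proof
    show "set_integrable lborel {0..} (\<lambda>x. poly p x * w x)" for p
      by (rule set_integrable_poly_weight[OF u]) (rule moment(1))
  qed (auto simp: w_def)
  have "wint (hyper_poly u (\<lambda>_. 1) \<alpha> n * u ^ j) = 0" if "j < n" for n j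
  proof -
    have "wint (hyper_poly u (\<lambda>_. 1) \<alpha> n * u ^ j) =
       (\<Sum>k\<le>n. (-1) ^ k * real (n choose k) * pochhammer (\<alpha> + real k + 1) (n - k) / fact n
          * wint (u ^ (k + j)))"
      by (simp add: hyper_poly_def sum_distrib_right wint_sum wint_smult power_add)
    also have "\<dots> = (\<Sum>k\<le>n. Gamma (\<alpha> + real n + 1) / fact n *
        ((-1) ^ k * real (n choose k) * pochhammer (\<alpha> + 1 + real k) j))"
    proof (intro sum.cong refl)
      fix k assume "k \<in> {..n}"
      then have k: "k \<le> n" by simp
      have "pochhammer (\<alpha> + real k + 1) i = Gamma (\<alpha> + real k + 1 + real i) / Gamma (\<alpha> + real k + 1)"
        for i using \<alpha> by (intro pochhammer_Gamma) (force simp: nonpos_Ints_def)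
      from this[of j] this[of "n - k"] k Gamma_real_pos[of "\<alpha> + real k + 1"] \<alpha>
      have "pochhammer (\<alpha> + real k + 1) (n - k) * wint (u ^ (k + j))
          = Gamma (\<alpha> + real n + 1) * pochhammer (\<alpha> + 1 + real k) j"
        unfolding wint_def moment(2) by (simp add: of_nat_diff add_ac field_simps)
      then show "(-1) ^ k * real (n choose k) * pochhammer (\<alpha> + real k + 1) (n - k) / fact n
          * wint (u ^ (k + j)) = Gamma (\<alpha> + real n + 1) / fact n *
          ((-1) ^ k * real (n choose k) * pochhammer (\<alpha> + 1 + real k) j)"
        by (simp add: mult_ac)
    qed
    also have "\<dots> = 0"
      unfolding sum_distrib_left [symmetric] sum_alternating_binomial_pochhammer_eq_0[OF that]
      by simp
    finally show ?thesis .
  qed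
  moreover have "degree (hyper_poly u (\<lambda>_. 1) \<alpha> n) = n" for n
    by (rule degree_hyper_poly) (simp_all add: u_def)
  moreover have "poly (hyper_poly u (\<lambda>_. 1) \<alpha> n) 0 = (real n + \<alpha>) gchoose n" for n
    by (rule poly_hyper_poly_root) (simp_all add: u_def)
  moreover have "(real n + \<alpha>) gchoose n \<noteq> 0" for n
    using gbinomial_shift_pos[OF \<alpha>, of n] by simp
  ultimately show ?thesis
    unfolding laguerre_poly_def w_def [symmetric] u_def [symmetric]
    by (intro the_orthogonal_poly_seq_eq[OF _ u]) auto
qed

lemma laguerre_poly_at_0_pos:
  assumes "\<alpha> > -1"
  shows "poly (laguerre_poly \<alpha> n) 0 > 0"
  unfolding laguerre_poly_eq[OF assms]
  by (subst poly_hyper_poly_root) (simp_all add: gbinomial_shift_pos assms)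

lemma laguerre_poly_contiguous:
  assumes "\<alpha> > -1" "n \<ge> 1"
  shows "laguerre_poly \<alpha> n = laguerre_poly (\<alpha> + 1) n - laguerre_poly (\<alpha> + 1) (n - 1)"
proof -
  have "\<alpha> + 1 > -1" using assms by simp
  note eqs = laguerre_poly_eq[OF assms(1)] laguerre_poly_eq[OF this]
  have "smult 1 (hyper_poly [:0, 1:] (\<lambda>_. 1) \<alpha> n) =
      smult 1 (hyper_poly [:0, 1:] (\<lambda>_. 1) (\<alpha> + 1) n)
      - smult 1 (hyper_poly [:0, 1:] (\<lambda>_. 1) (\<alpha> + 1) (n - 1))"
    by (rule hyper_poly_contiguous) (use assms in auto)
  then show ?thesis by (simp add: eqs)
qed

section \<open>The inequality\<close>

text \<open>The Engel form applied to $Mz = Kx + Ny$ and $Mz_0 = Kx_0 + Ny_0$, divided by \<open>K\<close>; the defect is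
  a multiple of $(x y_0 - y x_0)^2$.\<close>
lemma weighted_Cauchy_Schwarz:
  fixes K M N x y z x0 y0 z0 :: real
  assumes eq: "K * x = M * z - N * y" and eq0: "K * x0 = M * z0 - N * y0"
    and pos: "K > 0" "M > 0" "N > 0" "x0 > 0" "y0 > 0" "z0 > 0"
  shows "x\<^sup>2 / x0 + N / K * (y\<^sup>2 / y0) \<ge> M / K * (z\<^sup>2 / z0)"
proof -
  have z: "M * z = K * x + N * y" "M * z0 = K * x0 + N * y0" using eq eq0 by simp_all
  have "M * (z\<^sup>2 / z0) = (M * z)\<^sup>2 / (M * z0)"
    using pos by (simp add: power2_eq_square)
  also have "\<dots> \<le> K * (x\<^sup>2 / x0) + N * (y\<^sup>2 / y0)"
  proof -
    have "(K * (x\<^sup>2 / x0) + N * (y\<^sup>2 / y0)) * (K * x0 + N * y0) - (K * x + N * y)\<^sup>2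
        = K * N * (x * y0 - y * x0)\<^sup>2 / (x0 * y0)"
      using pos by (simp add: field_simps power2_eq_square)
    moreover have "\<dots> \<ge> 0" using pos by simp
    moreover have "K * x0 + N * y0 > 0" using pos by (simp add: add_pos_pos)
    ultimately show ?thesis unfolding z by (simp add: divide_le_eq)
  qed
  finally show ?thesis using pos by (simp add: field_simps)
qed

theorem proposition6:
  "(\<forall>(\<alpha>::real) (\<beta>::real) (n::nat) (x::real).
      \<alpha> > -1 \<longrightarrow> \<beta> > -1 \<longrightarrow> n \<ge> 1 \<longrightarrow> x \<in> {-1..1} \<longrightarrow>
      (poly (jacobi_poly \<alpha> \<beta> n) x)\<^sup>2 / poly (jacobi_poly \<alpha> \<beta> n) 1
      + (real n + \<beta>) / (2 * real n + \<alpha> + \<beta> + 1)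
        * ((poly (jacobi_poly (\<alpha> + 1) \<beta> (n - 1)) x)\<^sup>2 / poly (jacobi_poly (\<alpha> + 1) \<beta> (n - 1)) 1)
      \<ge> (real n + \<alpha> + \<beta> + 1) / (2 * real n + \<alpha> + \<beta> + 1)
        * ((poly (jacobi_poly (\<alpha> + 1) \<beta> n) x)\<^sup>2 / poly (jacobi_poly (\<alpha> + 1) \<beta> n) 1))
   \<and>
   (\<forall>(\<alpha>::real) (n::nat) (x::real).
      \<alpha> > -1 \<longrightarrow> n \<ge> 1 \<longrightarrow> x \<in> {0..} \<longrightarrow>
      (poly (laguerre_poly \<alpha> n) x)\<^sup>2 / poly (laguerre_poly \<alpha> n) 0
      + (poly (laguerre_poly (\<alpha> + 1) (n - 1)) x)\<^sup>2 / poly (laguerre_poly (\<alpha> + 1) (n - 1)) 0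
      \<ge> (poly (laguerre_poly (\<alpha> + 1) n) x)\<^sup>2 / poly (laguerre_poly (\<alpha> + 1) n) 0)"
proof (intro conjI allI impI)
  fix \<alpha> \<beta> x :: real and n :: nat
  assume \<alpha>: "\<alpha> > -1" and \<beta>: "\<beta> > -1" and n: "n \<ge> 1"
  have "(2 * real n + \<alpha> + \<beta> + 1) * poly (jacobi_poly \<alpha> \<beta> n) y =
      (real n + \<alpha> + \<beta> + 1) * poly (jacobi_poly (\<alpha> + 1) \<beta> n) y
      - (real n + \<beta>) * poly (jacobi_poly (\<alpha> + 1) \<beta> (n - 1)) y" for y
    using arg_cong[OF jacobi_poly_contiguous[OF \<alpha> \<beta> n], of "\<lambda>p. poly p y"] by simp
  from this[of x] this[of 1]
  show "(poly (jacobi_poly \<alpha> \<beta> n) x)\<^sup>2 / poly (jacobi_poly \<alpha> \<beta> n) 1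
      + (real n + \<beta>) / (2 * real n + \<alpha> + \<beta> + 1)
        * ((poly (jacobi_poly (\<alpha> + 1) \<beta> (n - 1)) x)\<^sup>2 / poly (jacobi_poly (\<alpha> + 1) \<beta> (n - 1)) 1)
      \<ge> (real n + \<alpha> + \<beta> + 1) / (2 * real n + \<alpha> + \<beta> + 1)
        * ((poly (jacobi_poly (\<alpha> + 1) \<beta> n) x)\<^sup>2 / poly (jacobi_poly (\<alpha> + 1) \<beta> n) 1)"
    by (rule weighted_Cauchy_Schwarz)
       (use \<alpha> \<beta> n in \<open>auto intro!: jacobi_poly_at_1_pos\<close>)
next
  fix \<alpha> x :: real and n :: nat
  assume \<alpha>: "\<alpha> > -1" and n: "n \<ge> 1"
  \<comment> \<open>The unit factors give the relation the shape with general \<open>K\<close>, \<open>M\<close>, \<open>N\<close>.\<close>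
  have "1 * poly (laguerre_poly \<alpha> n) y =
      1 * poly (laguerre_poly (\<alpha> + 1) n) y - 1 * poly (laguerre_poly (\<alpha> + 1) (n - 1)) y" for y
    by (simp add: laguerre_poly_contiguous[OF \<alpha> n])
  from weighted_Cauchy_Schwarz[OF this[of x] this[of 0]]
  show "(poly (laguerre_poly \<alpha> n) x)\<^sup>2 / poly (laguerre_poly \<alpha> n) 0
      + (poly (laguerre_poly (\<alpha> + 1) (n - 1)) x)\<^sup>2 / poly (laguerre_poly (\<alpha> + 1) (n - 1)) 0
      \<ge> (poly (laguerre_poly (\<alpha> + 1) n) x)\<^sup>2 / poly (laguerre_poly (\<alpha> + 1) n) 0"
    using \<alpha> by (auto simp: laguerre_poly_at_0_pos)
qed

end
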